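(* The function $\mu : \mathbb{N} \to \mathbb{N}$ is nondecreasing.
   Context: $\mathbb{N}$ denotes the set of positive integers. Fix an infinite set $D_0$ and recursively let $D_{n+1}$ be the set of finite non-empty subsets of $D_n$, for $n \geq 0$. For $k \geq 1$ and $n \geq 0$, define a set $\mathcal{F}^{(k)}_n$ of functions $D_0^k \to D_n$ by recursion on $n$: $\mathcal{F}^{(k)}_0$ is the set of the $k$ projections $(x_1,\dots,x_k) \mapsto x_i$ ($1 \leq i \leq k$); and $\mathcal{F}^{(k)}_{n+1}$ is the set of those functions $D_0^k \to D_{n+1}$ of the form $\mathbf{x} \mapsto \{g(\mathbf{x}) : g \in \mathcal{G}\}$ for some non-empty $\mathcal{G} \subseteq \mathcal{F}^{(k)}_n$. A pair $(k,n) \in \mathbb{N} \times \mathbb{N}$ is called good if $\mathcal{F}^{(k)}_n$ contains an injective function. For $k \in \mathbb{N}$, $\mu(k)$ is the least $n \in \mathbb{N}$ such that $(k,n)$ is good (for every $k \in \mathbb{N}$ such an $n$ exists, so $\mu$ is well-defined). *)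

theory Defs
  imports Main "HOL-Library.FSet" "HOL-Library.FuncSet"
begin

text \<open>
  The sets \<open>D\<^sub>0, D\<^sub>1, D\<^sub>2, \<dots>\<close> of the hierarchy live at different HOL types when read
  literally, so they are realised inside one type of hereditarily finite sets over atoms from
  \<open>'a\<close>. The elements of \<open>D\<^sub>0\<close> enter as atoms. All comparisons are between elements of the
  same level, where equality is equality of atoms or of sets.
\<close>

datatype 'a hfset = Atom 'a | HFSet "'a hfset fset"

primrec elems :: "'a hfset \<Rightarrow> 'a hfset set" where
  "elems (Atom a) = {}"
| "elems (HFSet A) = fset A"

primrec level :: "'a set \<Rightarrow> nat \<Rightarrow> 'a hfset set" where
  "level D0 0 = Atom ` D0"
| "level D0 (Suc n) = {HFSet A | A. A \<noteq> {||} \<and> fset A \<subseteq> level D0 n}"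

text \<open>\<open>k\<close>-tuples are functions on \<open>{1..k}\<close>, undefined elsewhere.\<close>

definition tuples :: "'a set \<Rightarrow> nat \<Rightarrow> (nat \<Rightarrow> 'a) set" where
  "tuples D0 k = {1..k} \<rightarrow>\<^sub>E D0"

text \<open>
  Functions on \<open>D\<^sub>0\<^sup>k\<close> are taken extensional, so that HOL equality of two members of
  \<open>\<F> D0 k n\<close> is equality as functions on \<open>D\<^sub>0\<^sup>k\<close>.
\<close>

primrec \<F> :: "'a set \<Rightarrow> nat \<Rightarrow> nat \<Rightarrow> ((nat \<Rightarrow> 'a) \<Rightarrow> 'a hfset) set" where
  "\<F> D0 k 0 = {(\<lambda>x\<in>tuples D0 k. Atom (x i)) | i. i \<in> {1..k}}"
| "\<F> D0 k (Suc n) =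
     {f \<in> tuples D0 k \<rightarrow>\<^sub>E level D0 (Suc n).
        \<exists>G. G \<noteq> {} \<and> G \<subseteq> \<F> D0 k n \<and> (\<forall>x\<in>tuples D0 k. elems (f x) = {g x | g. g \<in> G})}"

definition good :: "'a set \<Rightarrow> nat \<Rightarrow> nat \<Rightarrow> bool" where
  "good D0 k n \<longleftrightarrow> k \<ge> 1 \<and> n \<ge> 1 \<and> (\<exists>f \<in> \<F> D0 k n. inj_on f (tuples D0 k))"

definition \<mu> :: "'a set \<Rightarrow> nat \<Rightarrow> nat" where
  "\<mu> D0 k = (LEAST n. good D0 k n)"

end

theory Submission
  imports Defs
begin

text \<open>
  Let \<open>j \<le> k\<close> and let \<open>f\<close> be an injective member of \<open>\<F> D0 k n\<close>. Repeating the last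
  coordinate, \<open>(x\<^sub>1, \<dots>, x\<^sub>j) \<mapsto> f (x\<^sub>1, \<dots>, x\<^sub>j, x\<^sub>j, \<dots>, x\<^sub>j)\<close>, gives a function of \<open>j\<close> variables
  that is still injective, because the tuple can be read off from its padded version, and that
  still has rank \<open>n\<close>, because the families \<open>\<F>\<close> are closed under replacing variables by
  variables (\<open>substitution_in_\<F>\<close>). Hence goodness of \<open>(k, n)\<close> passes to \<open>(j, n)\<close>
  (\<open>good_fewer_variables\<close>), so the least good \<open>n\<close> for \<open>j\<close> is at most that for \<open>k\<close>.

  This comparison of least elements presupposes that some \<open>n\<close> is good for \<open>k\<close>. That is shown by
  induction on \<open>k\<close> (\<open>good_exists\<close>): an injective function of the first \<open>k\<close> variables is combined
  with the last variable, raised to the same rank by iterated singletons, in a Kuratowski pair.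
\<close>

definition reindex :: "(nat \<Rightarrow> nat) \<Rightarrow> nat \<Rightarrow> (nat \<Rightarrow> 'a) \<Rightarrow> nat \<Rightarrow> 'a" where
  "reindex s k x = (\<lambda>i\<in>{1..k}. x (s i))"

lemma reindex_in_tuples:
  assumes "s ` {1..k} \<subseteq> {1..j}" "x \<in> tuples D0 j"
  shows "reindex s k x \<in> tuples D0 k"
  using assms by (auto simp: reindex_def tuples_def PiE_iff)

lemma tuples_eqI:
  assumes "x \<in> tuples D0 k" "y \<in> tuples D0 k" "\<And>i. i \<in> {1..k} \<Longrightarrow> x i = y i"
  shows "x = y"
  using assms unfolding tuples_def by (rule PiE_ext)

lemma \<F>_in_level:
  assumes "f \<in> \<F> D0 k n" "x \<in> tuples D0 k"
  shows "f x \<in> level D0 n"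
proof (cases n)
  case 0
  with assms obtain i where "i \<in> {1..k}" "f x = Atom (x i)"
    by auto
  then show ?thesis
    using 0 assms(2) PiE_mem[of x "{1..k}" "\<lambda>_. D0" i] by (simp add: tuples_def)
next
  case (Suc m)
  with assms show ?thesis
    by (auto dest: PiE_mem simp del: level.simps)
qed

lemma \<F>_SucI:
  assumes "f \<in> tuples D0 k \<rightarrow>\<^sub>E level D0 (Suc n)" "G \<noteq> {}" "G \<subseteq> \<F> D0 k n"
    and "\<forall>x\<in>tuples D0 k. elems (f x) = {g x | g. g \<in> G}"
  shows "f \<in> \<F> D0 k (Suc n)"
  unfolding \<F>.simps(2) mem_Collect_eq using assms by (intro conjI exI[of _ G])

text \<open>
  Reindexing carries projections to projections and commutes with forming
  \<open>x \<mapsto> {g x | g \<in> G}\<close>, since evaluating all members of \<open>G\<close> at the reindexed tuple is the same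
  as evaluating the reindexed members.
\<close>

lemma substitution_in_\<F>:
  assumes s: "s ` {1..k} \<subseteq> {1..j}" and "f \<in> \<F> D0 k n"
  shows "(\<lambda>x\<in>tuples D0 j. f (reindex s k x)) \<in> \<F> D0 j n"
  using assms(2)
proof (induction n arbitrary: f)
  case 0
  then obtain i where i: "i \<in> {1..k}" and f: "f = (\<lambda>x\<in>tuples D0 k. Atom (x i))"
    by auto
  have "f (reindex s k x) = Atom (x (s i))" if "x \<in> tuples D0 j" for x
    using reindex_in_tuples[OF s that] i by (simp add: f) (simp add: reindex_def)
  then have "(\<lambda>x\<in>tuples D0 j. f (reindex s k x)) = (\<lambda>x\<in>tuples D0 j. Atom (x (s i)))"
    by (rule restrict_ext)
  moreover have "s i \<in> {1..j}"
    using s i by blast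
  ultimately show ?case
    unfolding \<F>.simps by blast
next
  case (Suc n)
  let ?sub = "\<lambda>g. \<lambda>x\<in>tuples D0 j. g (reindex s k x)"
  from Suc.prems have "\<exists>G. G \<noteq> {} \<and> G \<subseteq> \<F> D0 k n \<and>
      (\<forall>x\<in>tuples D0 k. elems (f x) = {g x | g. g \<in> G})"
    by simp
  then obtain G where G: "G \<noteq> {}" "G \<subseteq> \<F> D0 k n"
    and elems: "\<forall>x\<in>tuples D0 k. elems (f x) = {g x | g. g \<in> G}"
    by (elim exE conjE)
  have "?sub f \<in> tuples D0 j \<rightarrow>\<^sub>E level D0 (Suc n)"
    using \<F>_in_level[OF Suc.prems] reindex_in_tuples[OF s] by (auto simp del: level.simps)
  moreover have "?sub ` G \<noteq> {}" "?sub ` G \<subseteq> \<F> D0 j n"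
    using G Suc.IH by (simp, blast)
  moreover have "\<forall>x\<in>tuples D0 j. elems (?sub f x) = {g x | g. g \<in> ?sub ` G}"
    using elems reindex_in_tuples[OF s] by (auto simp: setcompr_eq_image image_image)
  ultimately show ?case
    by (rule \<F>_SucI)
qed

lemma good_fewer_variables:
  assumes "good D0 k n" "1 \<le> j" "j \<le> k"
  shows "good D0 j n"
proof -
  from assms(1) obtain f where n: "n \<ge> 1" and f: "f \<in> \<F> D0 k n" and inj: "inj_on f (tuples D0 k)"
    by (auto simp: good_def)
  \<comment> \<open>All coordinates beyond the \<open>j\<close>-th are filled with the \<open>j\<close>-th one.\<close>
  define s where "s = (\<lambda>i. min i j)"
  have s: "s ` {1..k} \<subseteq> {1..j}"
    using assms by (auto simp: s_def)
  have "inj_on (\<lambda>x\<in>tuples D0 j. f (reindex s k x)) (tuples D0 j)"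
  proof (rule inj_onI)
    fix x y
    assume x: "x \<in> tuples D0 j" and y: "y \<in> tuples D0 j"
      and "(\<lambda>x\<in>tuples D0 j. f (reindex s k x)) x = (\<lambda>x\<in>tuples D0 j. f (reindex s k x)) y"
    then have eq: "reindex s k x = reindex s k y"
      using inj reindex_in_tuples[OF s] by (auto dest: inj_onD)
    show "x = y"
    proof (rule tuples_eqI[OF x y])
      fix i assume "i \<in> {1..j}"
      then show "x i = y i"
        using fun_cong[OF eq, of i] \<open>j \<le> k\<close> by (simp add: reindex_def s_def)
    qed
  qed
  then show ?thesis
    using n \<open>1 \<le> j\<close> substitution_in_\<F>[OF s f] unfolding good_def by blast
qed

text \<open>
  This step suffices to build Kuratowski pairs: taking \<open>f = g\<close> supplies the singletons.
\<close>

lemma doubleton_in_\<F>: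
  assumes f: "f \<in> \<F> D0 k n" and g: "g \<in> \<F> D0 k n"
  shows "(\<lambda>x\<in>tuples D0 k. HFSet {|f x, g x|}) \<in> \<F> D0 k (Suc n)" (is "?h \<in> _")
proof -
  have "?h \<in> tuples D0 k \<rightarrow>\<^sub>E level D0 (Suc n)"
    using \<F>_in_level[OF f] \<F>_in_level[OF g] by auto
  moreover have "{f, g} \<noteq> {}" "{f, g} \<subseteq> \<F> D0 k n"
    using f g by auto
  moreover have "\<forall>x\<in>tuples D0 k. elems (?h x) = {h x | h. h \<in> {f, g}}"
    by auto
  ultimately show ?thesis
    by (rule \<F>_SucI)
qed

text \<open>
  The witness is the \<open>i\<close>-th projection wrapped in \<open>n\<close> nested singletons.
\<close>

lemma coordinate_at_every_level:
  assumes "i \<in> {1..k}"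
  shows "\<exists>g\<in>\<F> D0 k n. \<forall>x\<in>tuples D0 k. \<forall>y\<in>tuples D0 k. g x = g y \<longrightarrow> x i = y i"
proof (induction n)
  case 0
  show ?case
    using assms by (auto intro!: exI[of _ i])
next
  case (Suc n)
  then obtain g where g: "g \<in> \<F> D0 k n"
    and inj: "\<forall>x\<in>tuples D0 k. \<forall>y\<in>tuples D0 k. g x = g y \<longrightarrow> x i = y i"
    by blast
  show ?case
  proof (rule bexI[OF _ doubleton_in_\<F>[OF g g]], intro ballI impI)
    fix x y
    assume x: "x \<in> tuples D0 k" and y: "y \<in> tuples D0 k"
      and "(\<lambda>x\<in>tuples D0 k. HFSet {|g x, g x|}) x = (\<lambda>x\<in>tuples D0 k. HFSet {|g x, g x|}) y"
    then have "g x = g y"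
      by (simp add: fdoubleton_eq_iff)
    with inj x y show "x i = y i"
      by blast
  qed
qed

lemma kuratowski_pair_inject:
  "HFSet {|HFSet {|a, a|}, HFSet {|a, b|}|} = HFSet {|HFSet {|c, c|}, HFSet {|c, d|}|} \<longleftrightarrow>
    a = c \<and> b = d"
  by (simp only: hfset.inject fdoubleton_eq_iff) metis

text \<open>
  The two components of a Kuratowski pair must have the same rank, which is why the last variable
  is first raised to the rank of \<open>f\<close>. Each new variable then costs two levels.
\<close>

lemma good_Suc:
  assumes "good D0 k n"
  shows "good D0 (Suc k) (Suc (Suc n))"
proof -
  let ?T = "tuples D0 (Suc k)"
  from assms obtain f where f: "f \<in> \<F> D0 k n" and inj: "inj_on f (tuples D0 k)"
    by (auto simp: good_def)
  have id: "(\<lambda>i. i) ` {1..k} \<subseteq> {1..Suc k}"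
    by auto
  define f' where "f' = (\<lambda>x\<in>?T. f (reindex (\<lambda>i. i) k x))"
  have f': "f' \<in> \<F> D0 (Suc k) n"
    unfolding f'_def using substitution_in_\<F>[OF id f] .
  obtain g where g: "g \<in> \<F> D0 (Suc k) n"
    and g_last: "\<forall>x\<in>?T. \<forall>y\<in>?T. g x = g y \<longrightarrow> x (Suc k) = y (Suc k)"
    using coordinate_at_every_level[of "Suc k" "Suc k" D0 n] by auto
  define p where "p = (\<lambda>x\<in>?T. HFSet {|(\<lambda>x\<in>?T. HFSet {|f' x, f' x|}) x,
    (\<lambda>x\<in>?T. HFSet {|f' x, g x|}) x|})"
  have "p \<in> \<F> D0 (Suc k) (Suc (Suc n))"
    unfolding p_def by (intro doubleton_in_\<F> f' g)
  moreover have "inj_on p ?T"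
  proof (rule inj_onI)
    fix x y assume x: "x \<in> ?T" and y: "y \<in> ?T" and "p x = p y"
    then have "f' x = f' y" and last: "x (Suc k) = y (Suc k)"
      using g_last by (simp_all only: p_def restrict_apply' kuratowski_pair_inject)
    then have eq: "reindex (\<lambda>i. i) k x = reindex (\<lambda>i. i) k y"
      using x y inj reindex_in_tuples[OF id] by (auto simp: f'_def dest: inj_onD)
    show "x = y"
    proof (rule tuples_eqI[OF x y])
      fix i assume "i \<in> {1..Suc k}"
      then show "x i = y i"
        using fun_cong[OF eq, of i] last by (cases "i = Suc k") (auto simp: reindex_def)
    qed
  qed
  ultimately show ?thesis
    by (auto simp: good_def simp del: \<F>.simps)
qed

lemma good_1: "good D0 1 1"
proof -
  obtain g where g: "g \<in> \<F> D0 1 1"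
    and first: "\<forall>x\<in>tuples D0 1. \<forall>y\<in>tuples D0 1. g x = g y \<longrightarrow> x 1 = y 1"
    using coordinate_at_every_level[of 1 1 D0 1] by (auto simp del: \<F>.simps)
  have "inj_on g (tuples D0 1)"
  proof (rule inj_onI)
    fix x y
    assume x: "x \<in> tuples D0 1" and y: "y \<in> tuples D0 1" and "g x = g y"
    with first have "x 1 = y 1"
      by blast
    then show "x = y"
      by (intro tuples_eqI[OF x y]) simp
  qed
  with g show ?thesis
    unfolding good_def by blast
qed

lemma good_exists:
  assumes "1 \<le> k"
  shows "\<exists>n. good D0 k n"
  using assms
proof (induction k rule: dec_induct)
  case base
  show ?case using good_1 by blast
next
  case (step k)
  then show ?case using good_Suc by blast
qed

theorem theorem3p1:
  fixes D0 :: "'a set"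
  assumes "infinite D0"
  shows "mono_on {1..} (\<mu> D0)"
proof (rule mono_onI)
  fix j k :: nat
  assume "j \<in> {1..}" "k \<in> {1..}" "j \<le> k"
  then have "1 \<le> j" "1 \<le> k"
    by auto
  have "good D0 k (\<mu> D0 k)"
    unfolding \<mu>_def using good_exists[OF \<open>1 \<le> k\<close>] by (rule LeastI_ex)
  then have "good D0 j (\<mu> D0 k)"
    using \<open>1 \<le> j\<close> \<open>j \<le> k\<close> by (rule good_fewer_variables)
  then show "\<mu> D0 j \<le> \<mu> D0 k"
    unfolding \<mu>_def[of D0 j] by (rule Least_le)
qed

end
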